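(* Let $n\geqslant 1$ and $m\in\{\bullet,\circ\}^n$. Then $$w(m)=\sum_{\substack{T \text{ staircase tableau of size } n\\ \mathrm{type}(T)=m}} w(T).$$
   Context: Weight of words (with the convention $u=1$): $w:\{\bullet,\circ\}^*\to\mathbb{Z}[\alpha,\beta,\gamma,\delta,q]$ is defined recursively by $w(\varepsilon)=1$ and, for every word $X$ of length $n\geqslant 0$, $$w(\bullet X)=\alpha\delta\sum_{X=U\bullet V}q^{|\circ(U)|+|V|}\big(w(U\bullet V)+w(U\circ V)\big)+q^n\delta\,w(X)+q^{|\circ(X)|}\alpha\,w(X)+\alpha\beta\sum_{X=U\circ V}q^{|\circ(U)|}\big(w(U\bullet V)+w(U\circ V)\big),$$ $$w(\circ X)=\gamma\delta\sum_{X=U\bullet V}q^{|\circ(U)|+|V|}\big(w(U\bullet V)+w(U\circ V)\big)+q^{|\circ(X)|}\gamma\,w(X)+\gamma\beta\sum_{X=U\circ V}q^{|\circ(U)|}\big(w(U\bullet V)+w(U\circ V)\big)+\beta\,w(X).$$ Here $\varepsilon$ is the empty word, $|X|$ is the length and $|\circ(X)|$ the number of letters $\circ$ of $X$, and $\sum_{X=U\bullet V}$ (resp. $\sum_{X=U\circ V}$) runs over all factorizations of $X$ around an occurrence of $\bullet$ (resp. $\circ$). (This is the solution $h^{\lambda}$ of the generalized matrix ansatz of Derrida–Evans–Hakim–Pasquier/Corteel–Williams for $\lambda_0=1$, $\lambda_k=u^{k-1}\alpha\beta-q^{k-1}\gamma\delta$, specialized at $u=1$.) Staircase tableaux: for $n\geqslant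 1$, the staircase shape of size $n$ is the set of cells $(i,j)$, $1\leqslant j\leqslant i\leqslant n$, rows numbered bottom to top and columns left to right (row $i$ is $(i,1),\dots,(i,i)$; column $j$ is $(j,j),\dots,(n,j)$ bottom to top); $c_i=(i,i)$. A staircase tableau of size $n$ is a filling in which each cell is empty or labelled by one of $\alpha,\beta,\gamma,\delta$ such that every $c_i$ is labelled, all cells above (same column) a cell labelled $\alpha$ or $\gamma$ are empty, and all cells to the left (same row) of a cell labelled $\beta$ or $\delta$ are empty. Its type is $m_n\cdots m_1$ with $m_i=\bullet$ if $c_i\in\{\alpha,\delta\}$ and $m_i=\circ$ if $c_i\in\{\beta,\gamma\}$. Weight (with $u=1$): an empty cell $e$ receives $q$ if the nearest labelled cell to its right in its row is labelled $\delta$, or if that cell is labelled $\alpha$ or $\gamma$ and the nearest labelled cell below $e$ in its column is labelled $\beta$ or $\gamma$; otherwise it receives $1$. $w(T)$ is the product of all labels times $q^N$, $N$ the number of empty cells receiving $q$. *)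

theory Defs
  imports "HOL-Library.Poly_Mapping"
begin

datatype label = Alpha | Beta | Gamma | Delta

datatype indet = Label label | Q

text \<open>
  The polynomial ring over the integers in the five indeterminates
  \<open>\<alpha>, \<beta>, \<gamma>, \<delta>, q\<close>: finitely supported integer coefficients on monomials, and monomials
  are finitely supported exponent maps.  Multiplication is the convolution product
  of \<^theory>\<open>HOL-Library.Poly_Mapping\<close>.
\<close>

type_synonym weight = "(indet \<Rightarrow>\<^sub>0 nat) \<Rightarrow>\<^sub>0 int"

definition var :: "indet \<Rightarrow> weight" where
  "var x = Poly_Mapping.single (Poly_Mapping.single x 1) 1"

abbreviation al :: weight ("\<alpha>") where "\<alpha> \<equiv> var (Label Alpha)"
abbreviation be :: weight ("\<beta>") where "\<beta> \<equiv> var (Label Beta)"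
abbreviation ga :: weight ("\<gamma>") where "\<gamma> \<equiv> var (Label Gamma)"
abbreviation de :: weight ("\<delta>") where "\<delta> \<equiv> var (Label Delta)"
abbreviation q :: weight where "q \<equiv> var Q"

datatype letter = Bullet ("\<bullet>") | Circ ("\<circle>")

type_synonym word = "letter list"

definition circs :: "word \<Rightarrow> nat" where
  "circs X = count_list X \<circle>"

definition factorizations :: "letter \<Rightarrow> word \<Rightarrow> (word \<times> word) set" where
  "factorizations a X = {(U, V). X = U @ a # V}"

lemma finite_factorizations: "finite (factorizations a X)"
proof (rule finite_subset)
  show "factorizations a X \<subseteq> (\<lambda>k. (take k X, drop (Suc k) X)) ` {..length X}"
  proof
    fix p assume "p \<in> factorizations a X"
    then obtain U V where "p = (U, V)" "X = U @ a # V"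
      by (auto simp: factorizations_def)
    then show "p \<in> (\<lambda>k. (take k X, drop (Suc k) X)) ` {..length X}"
      by (intro image_eqI[of _ _ "length U"]) auto
  qed
qed simp

lemma length_factorizations:
  "(U, V) \<in> factorizations a X \<Longrightarrow> length X = Suc (length U + length V)"
  by (auto simp: factorizations_def)

function w :: "word \<Rightarrow> weight" where
  "w [] = 1"
| "w (\<bullet> # X) =
     \<alpha> * \<delta> * (\<Sum>(U, V)\<in>factorizations \<bullet> X.
        q ^ (circs U + length V) * (w (U @ \<bullet> # V) + w (U @ \<circle> # V)))
     + q ^ length X * \<delta> * w X
     + q ^ circs X * \<alpha> * w X
     + \<alpha> * \<beta> * (\<Sum>(U, V)\<in>factorizations \<circle> X.
        q ^ circs U * (w (U @ \<bullet> # V) + w (U @ \<circle> # V)))"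
| "w (\<circle> # X) =
     \<gamma> * \<delta> * (\<Sum>(U, V)\<in>factorizations \<bullet> X.
        q ^ (circs U + length V) * (w (U @ \<bullet> # V) + w (U @ \<circle> # V)))
     + q ^ circs X * \<gamma> * w X
     + \<gamma> * \<beta> * (\<Sum>(U, V)\<in>factorizations \<circle> X.
        q ^ circs U * (w (U @ \<bullet> # V) + w (U @ \<circle> # V)))
     + \<beta> * w X"
  by pat_completeness auto
termination
  by (relation "measure length") (auto dest: length_factorizations)

text \<open>
  The cell \<open>(i, j)\<close> lies in row \<open>i\<close> (numbered bottom to top) and column \<open>j\<close>; a filling maps
  labelled cells to their label, and all other cells, in particular those outside the shape,
  to \<open>None\<close>.
\<close>

type_synonym cell = "nat \<times> nat"
type_synonym filling = "cell \<rightharpoonup> label"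

definition staircase_shape :: "nat \<Rightarrow> cell set" where
  "staircase_shape n = {(i, j). 1 \<le> j \<and> j \<le> i \<and> i \<le> n}"

definition staircase_tableaux :: "nat \<Rightarrow> filling set" where
  "staircase_tableaux n = {T.
     dom T \<subseteq> staircase_shape n \<and>
     (\<forall>i. 1 \<le> i \<and> i \<le> n \<longrightarrow> T (i, i) \<noteq> None) \<and>
     (\<forall>(i, j)\<in>staircase_shape n. T (i, j) \<in> {Some Alpha, Some Gamma} \<longrightarrow>
        (\<forall>i'. i < i' \<and> i' \<le> n \<longrightarrow> T (i', j) = None)) \<and>
     (\<forall>(i, j)\<in>staircase_shape n. T (i, j) \<in> {Some Beta, Some Delta} \<longrightarrow>
        (\<forall>j'. 1 \<le> j' \<and> j' < j \<longrightarrow> T (i, j') = None))}"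

fun letter_of_label :: "label \<Rightarrow> letter" where
  "letter_of_label Alpha = \<bullet>"
| "letter_of_label Delta = \<bullet>"
| "letter_of_label Beta = \<circle>"
| "letter_of_label Gamma = \<circle>"

text \<open>The type is read from the top diagonal cell \<open>(n, n)\<close> down to \<open>(1, 1)\<close>.\<close>

definition tableau_type :: "nat \<Rightarrow> filling \<Rightarrow> word" where
  "tableau_type n T = map (\<lambda>i. letter_of_label (the (T (i, i)))) (rev [1..<Suc n])"

text \<open>
  For an empty cell \<open>(i, j)\<close> of a staircase tableau, the two sets below contain \<open>i\<close>
  and \<open>j\<close> respectively, since diagonal cells are labelled; so \<open>Min\<close> and \<open>Max\<close>
  are taken over nonempty finite sets.
\<close>

definition right_label :: "filling \<Rightarrow> cell \<Rightarrow> label" where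
  "right_label T = (\<lambda>(i, j). the (T (i, Min {k. j < k \<and> k \<le> i \<and> T (i, k) \<noteq> None})))"

definition below_label :: "filling \<Rightarrow> cell \<Rightarrow> label" where
  "below_label T = (\<lambda>(i, j). the (T (Max {k. j \<le> k \<and> k < i \<and> T (k, j) \<noteq> None}, j)))"

definition q_cells :: "nat \<Rightarrow> filling \<Rightarrow> cell set" where
  "q_cells n T = {e \<in> staircase_shape n. T e = None \<and>
     (right_label T e = Delta \<or>
      right_label T e \<in> {Alpha, Gamma} \<and> below_label T e \<in> {Beta, Gamma})}"

definition tableau_weight :: "nat \<Rightarrow> filling \<Rightarrow> weight" where
  "tableau_weight n T = (\<Prod>e\<in>dom T. var (Label (the (T e)))) * q ^ card (q_cells n T)"

lemma finite_staircase_shape: "finite (staircase_shape n)"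
  by (rule finite_subset[of _ "{..n} \<times> {..n}"]) (auto simp: staircase_shape_def)

lemma finite_staircase_tableaux: "finite (staircase_tableaux n)"
proof -
  have "finite (UNIV :: label set)"
    by (rule finite_subset[of _ "{Alpha, Beta, Gamma, Delta}"]) (auto intro: label.exhaust)
  then have "finite (\<Union>A\<in>Pow (staircase_shape n). {T :: filling. dom T = A \<and> ran T \<subseteq> UNIV})"
    using finite_staircase_shape[of n]
    by (intro finite_UN_I finite_set_of_finite_maps) (auto intro: finite_subset)
  then show ?thesis
    by (rule rev_finite_subset) (auto simp: staircase_tableaux_def)
qed

end

theory Submission
  imports Defs
begin

text \<open>
  Build a tableau by adding columns on the left.  A new column sees of the old tableau only the
  leftmost label of each row: a row is open if this label is \<open>\<alpha>\<close> or \<open>\<gamma>\<close>, while a \<open>\<beta>\<close>-row stays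
  empty with weight 1 and a \<open>\<delta>\<close>-row stays empty with weight \<open>q\<close> per new column.  Hence the numbers
  of open rows and of \<open>\<delta>\<close>-rows suffice as state.  The first letter of a word \<open>aX\<close> creates a
  single row; if it is open, one asks in which of the columns of \<open>X\<close> it receives its next label.
  That column has \<open>\<delta>\<close> (for \<open>\<bullet>\<close>) or \<open>\<beta>\<close> (for \<open>\<circle>\<close>) on the diagonal, and deleting this diagonal
  cell makes the new label an arbitrary diagonal label, which gives the two sums over
  factorizations of \<open>X\<close>.
\<close>

section \<open>Weights and transfer operators of a single column\<close>

lemma UNIV_label: "(UNIV :: label set) = {Alpha, Beta, Gamma, Delta}"
  by (auto intro: label.exhaust)

lemma labels_of_letter:
  "{l. letter_of_label l = \<bullet>} = {Alpha, Delta}"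
  "{l. letter_of_label l = \<circle>} = {Beta, Gamma}"
proof -
  have "letter_of_label l = \<bullet> \<longleftrightarrow> l \<in> {Alpha, Delta}"
    "letter_of_label l = \<circle> \<longleftrightarrow> l \<in> {Beta, Gamma}" for l
    by (cases l; simp)+
  then show "{l. letter_of_label l = \<bullet>} = {Alpha, Delta}"
    "{l. letter_of_label l = \<circle>} = {Beta, Gamma}"
    by auto
qed

text \<open>Weight of an empty cell whose nearest label below is \<open>b\<close> and whose nearest
  label to the right is \<open>r\<close>.\<close>

definition gap :: "label \<Rightarrow> label \<Rightarrow> weight" where
  "gap b r = (if r = Delta \<or> r \<in> {Alpha, Gamma} \<and> b \<in> {Beta, Gamma} then q else 1)"

text \<open>The arguments of \<open>f\<close> are the numbers of open rows and of \<delta>-rows; one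
  row with leftmost label \<open>l\<close> is added to them.\<close>

definition push :: "label \<Rightarrow> (nat \<Rightarrow> nat \<Rightarrow> weight) \<Rightarrow> nat \<Rightarrow> nat \<Rightarrow> weight" where
  "push l f k d = f (if l \<in> {Alpha, Gamma} then Suc k else k) (if l = Delta then Suc d else d)"

lemma push_simps [simp]:
  "push Alpha f = (\<lambda>k d. f (Suc k) d)"
  "push Beta f = f"
  "push Gamma f = (\<lambda>k d. f (Suc k) d)"
  "push Delta f = (\<lambda>k d. f k (Suc d))"
  by (auto simp: push_def fun_eq_iff)

text \<open>
  In \<open>column_sum b i f\<close>, a column is being filled from bottom to top, \<open>b\<close> is its highest label so
  far, and \<open>i\<close> open rows remain above; \<open>f\<close> is evaluated at the resulting numbers of open rows and
  of \<open>\<delta>\<close>-rows.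
\<close>

fun column_sum :: "label \<Rightarrow> nat \<Rightarrow> (nat \<Rightarrow> nat \<Rightarrow> weight) \<Rightarrow> weight" where
  "column_sum b 0 f = f 0 0"
| "column_sum b (Suc i) f = gap b Alpha * column_sum b i (\<lambda>k d. f (Suc k) d) +
     (if b \<in> {Beta, Delta}
      then \<Sum>l\<in>UNIV. var (Label l) * column_sum l i (push l f) else 0)"

text \<open>A transfer operator acting on the continuation \<open>f\<close>. Each of the
  \<open>d\<close> old \<delta>-rows has an empty cell of weight \<open>q\<close> in the new column
  and remains a \<delta>-row, hence \<open>q ^ d\<close> and \<open>j + d\<close>.\<close>

definition add_column :: "letter \<Rightarrow> (nat \<Rightarrow> nat \<Rightarrow> weight) \<Rightarrow> nat \<Rightarrow> nat \<Rightarrow> weight" where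
  "add_column a f k d = q ^ d * (\<Sum>l | letter_of_label l = a.
     var (Label l) * column_sum l k (push l (\<lambda>i j. f i (j + d))))"

lemma column_sum_add:
  "column_sum b i (\<lambda>k d. f k d + g k d) = column_sum b i f + column_sum b i g"
  by (induction i arbitrary: b f g) (auto simp: UNIV_label algebra_simps)

lemma column_sum_mult:
  "column_sum b i (\<lambda>k d. c * f k d) = c * column_sum b i f"
  by (induction i arbitrary: b f) (auto simp: UNIV_label distrib_left mult.left_commute)

text \<open>Linearity in \<open>f\<close> is what carries a recursion for the later columns through
  an earlier one.\<close>

lemma add_column_add:
  "add_column a (\<lambda>k d. f k d + g k d) k d = add_column a f k d + add_column a g k d"
  by (cases a) (auto simp: add_column_def labels_of_letter column_sum_add algebra_simps)

lemma add_column_mult: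
  "add_column a (\<lambda>k d. c * f k d) k d = c * add_column a f k d"
  by (cases a) (auto simp: add_column_def labels_of_letter column_sum_mult distrib_left mult.left_commute)

lemma add_column_sum:
  "finite S \<Longrightarrow> add_column a (\<lambda>k d. \<Sum>x\<in>S. f x k d) k d = (\<Sum>x\<in>S. add_column a (f x) k d)"
proof (induction S rule: finite_induct)
  case empty
  show ?case using add_column_mult[of a 0 "\<lambda>_ _. 0" k d] by simp
next
  case (insert x S)
  then show ?case by (simp add: add_column_add)
qed

lemma add_column_shift:
  "add_column a f k (Suc d) = q * add_column a (\<lambda>k d. f k (Suc d)) k d"
  by (cases a) (auto simp: add_column_def labels_of_letter algebra_simps)

text \<open>Classify the columns by the content of the lowest open row: if it stays empty it can be
  deleted, otherwise its label acts as the diagonal cell of a column over the remaining rows.\<close>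

lemma add_column_Bullet_Suc:
  "add_column \<bullet> f (Suc k) d = add_column \<bullet> (\<lambda>k d. f (Suc k) d) k d
     + \<delta> * (add_column \<bullet> (\<lambda>k d. f k (Suc d)) k d + add_column \<circle> (\<lambda>k d. f k (Suc d)) k d)"
  by (simp add: add_column_def labels_of_letter UNIV_label gap_def algebra_simps)

lemma add_column_Circ_Suc:
  "add_column \<circle> f (Suc k) d = q * add_column \<circle> (\<lambda>k d. f (Suc k) d) k d
     + \<beta> * (add_column \<bullet> f k d + add_column \<circle> f k d)"
  by (simp add: add_column_def labels_of_letter UNIV_label gap_def algebra_simps)

section \<open>Successive columns and the recursion for \<open>w\<close>\<close>

text \<open>The first letter belongs to the rightmost column, which is placed first; the rest of the
  word is its continuation.\<close>

primrec add_columns :: "word \<Rightarrow> (nat \<Rightarrow> nat \<Rightarrow> weight) \<Rightarrow> nat \<Rightarrow> nat \<Rightarrow> weight" where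
  "add_columns [] f = f"
| "add_columns (a # X) f = add_column a (add_columns X f)"

text \<open>\<open>completions X k d\<close> is the total weight of all ways to place the columns of
  \<open>X\<close> to the left of \<open>k\<close> open rows and \<open>d\<close>
  \<delta>-rows.\<close>

abbreviation completions :: "word \<Rightarrow> nat \<Rightarrow> nat \<Rightarrow> weight" where
  "completions X \<equiv> add_columns X (\<lambda>_ _. 1)"

text \<open>Each column of \<open>X\<close> meets the additional \<delta>-row in one empty cell of
  weight \<open>q\<close>.\<close>

lemma completions_delta: "completions X k (Suc d) = q ^ length X * completions X k d"
proof (induction X arbitrary: k d)
  case (Cons a X)
  then have "(\<lambda>k d. completions X k (Suc d)) = (\<lambda>k d. q ^ length X * completions X k d)"
    by (simp add: fun_eq_iff)
  then show ?case
    by (simp add: add_column_shift add_column_mult mult.assoc)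
qed simp

lemma factorizations_Nil [simp]: "factorizations b [] = {}"
  by (simp add: factorizations_def)

lemma factorizations_Cons:
  "factorizations b (a # X) =
     (if a = b then {([], X)} else {}) \<union> (\<lambda>(U, V). (a # U, V)) ` factorizations b X"
  by (force simp: factorizations_def Cons_eq_append_conv)

lemma sum_factorizations_Cons:
  fixes h :: "word \<Rightarrow> word \<Rightarrow> weight"
  shows "(\<Sum>(U, V)\<in>factorizations b (a # X). h U V) =
     (if a = b then h [] X else 0) + (\<Sum>(U, V)\<in>factorizations b X. h (a # U) V)"
proof -
  have "(\<Sum>(U, V)\<in>(\<lambda>(U, V). (a # U, V)) ` factorizations b X. h U V) =
        (\<Sum>(U, V)\<in>factorizations b X. h (a # U) V)"
    by (subst sum.reindex) (auto simp: inj_on_def case_prod_beta)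
  then show ?thesis
    unfolding factorizations_Cons
    by (subst sum.union_disjoint) (auto simp: finite_factorizations)
qed

text \<open>Follow one open row. As long as it stays empty it costs \<open>q\<close> in each
  \<circle> column and 1 in each \<bullet> column. If its next label comes between \<open>U\<close>
  and \<open>V\<close>, the diagonal there is \<delta> or \<beta>. Deleting that diagonal cell makes
  the new label a diagonal label of either letter, hence two words per summand; a deleted \<delta>
  still costs \<open>q\<close> in every column of \<open>V\<close>.\<close>

lemma completions_open:
  "completions X (Suc k) d =
     \<delta> * (\<Sum>(U, V)\<in>factorizations \<bullet> X. q ^ (circs U + length V) *
        (completions (U @ \<bullet> # V) k d + completions (U @ \<circle> # V) k d))
     + q ^ circs X * completions X k d
     + \<beta> * (\<Sum>(U, V)\<in>factorizations \<circle> X. q ^ circs U *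
        (completions (U @ \<bullet> # V) k d + completions (U @ \<circle> # V) k d))"
proof (induction X arbitrary: k d)
  case Nil
  show ?case by (simp add: circs_def)
next
  case (Cons a X)
  \<comment> \<open>The row stays empty in the first column and is followed further. A new open row
    may now lie below it, which is harmless because \<open>completions\<close> depends only on the
    number of open rows.\<close>
  have step: "add_column a (\<lambda>k d. completions X (Suc k) d) k d =
     \<delta> * (\<Sum>(U, V)\<in>factorizations \<bullet> X. q ^ (circs U + length V) *
        (completions (a # U @ \<bullet> # V) k d + completions (a # U @ \<circle> # V) k d))
     + q ^ circs X * completions (a # X) k d
     + \<beta> * (\<Sum>(U, V)\<in>factorizations \<circle> X. q ^ circs U *
        (completions (a # U @ \<bullet> # V) k d + completions (a # U @ \<circle> # V) k d))"
    unfolding Cons.IH case_prod_beta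
    by (simp add: add_column_add add_column_mult add_column_sum finite_factorizations)
  \<comment> \<open>Here \<open>c\<close> is the letter of the first column after its diagonal
    \<delta> has been deleted; the \<delta>-row is paid for in the columns of
    \<open>X\<close>.\<close>
  have delta: "add_column c (\<lambda>k d. completions X k (Suc d)) k d =
      q ^ length X * completions (c # X) k d" for c
    unfolding completions_delta by (simp add: add_column_mult)
  show ?case
  proof (cases a)
    case Bullet
    show ?thesis
      using step unfolding Bullet
      by (simp add: add_column_Bullet_Suc delta sum_factorizations_Cons circs_def algebra_simps)
  next
    case Circ
    show ?thesis
      using step unfolding Circ
      by (subst (1 2) sum_factorizations_Cons)
        (simp add: add_column_Circ_Suc circs_def algebra_simps sum_distrib_left case_prod_beta)
  qed
qed

text \<open>The first column is a single cell. A label \<alpha> or \<gamma> opens a row, which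
  \<open>completions_open\<close> expands into sums over factorizations; \<delta> gives the factor
  \<open>q ^ length X\<close>, and \<beta> a row of weight 1.\<close>

lemma w_eq_completions: "w X = completions X 0 0"
proof (induction X rule: w.induct)
  case 1
  show ?case by simp
next
  case (2 X)
  have [simp]: "completions X 0 (Suc 0) = q ^ length X * completions X 0 0"
    by (rule completions_delta)
  have "(\<Sum>(U, V)\<in>factorizations \<bullet> X. q ^ (circs U + length V) * (w (U @ \<bullet> # V) + w (U @ \<circle> # V)))
      = (\<Sum>(U, V)\<in>factorizations \<bullet> X. q ^ (circs U + length V) *
          (completions (U @ \<bullet> # V) 0 0 + completions (U @ \<circle> # V) 0 0))"
    "(\<Sum>(U, V)\<in>factorizations \<circle> X. q ^ circs U * (w (U @ \<bullet> # V) + w (U @ \<circle> # V)))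
      = (\<Sum>(U, V)\<in>factorizations \<circle> X. q ^ circs U *
          (completions (U @ \<bullet> # V) 0 0 + completions (U @ \<circle> # V) 0 0))"
    using 2 by (auto intro!: sum.cong)
  moreover have "completions (\<bullet> # X) 0 0 =
      \<alpha> * completions X (Suc 0) 0 + \<delta> * completions X 0 (Suc 0)"
    by (simp add: add_column_def labels_of_letter)
  ultimately show ?case
    using 2 by (simp add: completions_open algebra_simps del: add_columns.simps)
next
  case (3 X)
  have "(\<Sum>(U, V)\<in>factorizations \<bullet> X. q ^ (circs U + length V) * (w (U @ \<bullet> # V) + w (U @ \<circle> # V)))
      = (\<Sum>(U, V)\<in>factorizations \<bullet> X. q ^ (circs U + length V) *
          (completions (U @ \<bullet> # V) 0 0 + completions (U @ \<circle> # V) 0 0))"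
    "(\<Sum>(U, V)\<in>factorizations \<circle> X. q ^ circs U * (w (U @ \<bullet> # V) + w (U @ \<circle> # V)))
      = (\<Sum>(U, V)\<in>factorizations \<circle> X. q ^ circs U *
          (completions (U @ \<bullet> # V) 0 0 + completions (U @ \<circle> # V) 0 0))"
    using 3 by (auto intro!: sum.cong)
  moreover have "completions (\<circle> # X) 0 0 =
      \<beta> * completions X 0 0 + \<gamma> * completions X (Suc 0) 0"
    by (simp add: add_column_def labels_of_letter)
  ultimately show ?case
    using 3 by (simp add: completions_open algebra_simps del: add_columns.simps)
qed

section \<open>Fillings of one column next to given rows\<close>

text \<open>The cells above a label \<open>b\<close>, from bottom to top, with \<open>None\<close>
  for an empty cell; \<open>s\<close> lists the leftmost labels of their rows. The highest label so
  far is carried along as \<open>b\<close>.\<close>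

primrec columns :: "label \<Rightarrow> label list \<Rightarrow> label option list set" where
  "columns b [] = {[]}"
| "columns b (r # s) = Cons None ` columns b s \<union>
     (if r \<in> {Alpha, Gamma} \<and> b \<in> {Beta, Delta}
      then \<Union>l. Cons (Some l) ` columns l s else {})"

primrec column_weight :: "label \<Rightarrow> label list \<Rightarrow> label option list \<Rightarrow> weight" where
  "column_weight b s [] = 1"
| "column_weight b s (x # c) = (case x of
     None \<Rightarrow> gap b (hd s) * column_weight b (tl s) c
   | Some l \<Rightarrow> var (Label l) * column_weight l (tl s) c)"

text \<open>The leftmost labels of the rows once the column \<open>c\<close> stands on their
  left.\<close>

definition relabel :: "label list \<Rightarrow> label option list \<Rightarrow> label list" where
  "relabel s c = map (\<lambda>(r, x). case x of None \<Rightarrow> r | Some l \<Rightarrow> l) (zip s c)"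

definition opens :: "label list \<Rightarrow> nat" where
  "opens s = length (filter (\<lambda>l. l \<in> {Alpha, Gamma}) s)"

definition deltas :: "label list \<Rightarrow> nat" where
  "deltas s = count_list s Delta"

lemma push_opens_deltas:
  "f (opens (l # s)) (deltas (l # s)) = push l f (opens s) (deltas s)"
  by (cases l) (auto simp: opens_def deltas_def)

lemma finite_columns [simp]: "finite (columns b s)"
  by (induction s arbitrary: b) (auto simp: UNIV_label)

lemma sum_columns_Cons:
  fixes h :: "label option list \<Rightarrow> weight"
  shows "(\<Sum>c\<in>columns b (r # s). h c) = (\<Sum>c\<in>columns b s. h (None # c)) +
     (if r \<in> {Alpha, Gamma} \<and> b \<in> {Beta, Delta}
      then \<Sum>l\<in>UNIV. \<Sum>c\<in>columns l s. h (Some l # c) else 0)"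
proof -
  have *: "(\<Sum>c\<in>Cons x ` columns l s. h c) = (\<Sum>c\<in>columns l s. h (x # c))" for x l
    by (subst sum.reindex) (auto simp: inj_on_def)
  have "finite (UNIV :: label set)" by (simp add: UNIV_label)
  then have "(\<Sum>c\<in>(\<Union>l. Cons (Some l) ` columns l s). h c) =
      (\<Sum>l\<in>UNIV. \<Sum>c\<in>columns l s. h (Some l # c))"
    by (subst sum.UNION_disjoint) (auto simp: *)
  moreover have "finite (\<Union>l. Cons (Some l) ` columns l s)"
    by (simp add: UNIV_label)
  ultimately show ?thesis
    by (auto simp: * sum.union_disjoint image_iff intro!: sum.union_disjoint[THEN trans])
qed

text \<open>Only the two counts matter: \<beta>-rows and \<delta>-rows stay empty with weights 1 and
  \<open>q\<close> and keep their labels, while an open row offers exactly the choices in the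
  recursion of \<open>column_sum\<close>.\<close>

lemma sum_columns:
  "(\<Sum>c\<in>columns b s. column_weight b s c * f (opens (relabel s c)) (deltas (relabel s c)))
   = q ^ deltas s * column_sum b (opens s) (\<lambda>k d. f k (d + deltas s))"
proof (induction s arbitrary: b f)
  case Nil
  show ?case by (simp add: relabel_def opens_def deltas_def)
next
  case (Cons r s)
  have empty: "(\<Sum>c\<in>columns b s. column_weight b (r # s) (None # c) *
        f (opens (relabel (r # s) (None # c))) (deltas (relabel (r # s) (None # c))))
      = gap b r * (q ^ deltas s * column_sum b (opens s) (\<lambda>k d. push r f k (d + deltas s)))"
    unfolding Cons.IH[symmetric] sum_distrib_left
    by (intro sum.cong) (auto simp: relabel_def push_opens_deltas mult.assoc)
  have filled: "(\<Sum>c\<in>columns l s. column_weight b (r # s) (Some l # c) *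
        f (opens (relabel (r # s) (Some l # c))) (deltas (relabel (r # s) (Some l # c))))
      = var (Label l) * (q ^ deltas s * column_sum l (opens s) (\<lambda>k d. push l f k (d + deltas s)))"
    for l
    unfolding Cons.IH[symmetric] sum_distrib_left
    by (intro sum.cong) (auto simp: relabel_def push_opens_deltas mult.assoc)
  show ?case
    unfolding sum_columns_Cons empty filled
    by (cases r) (auto simp: opens_def deltas_def gap_def UNIV_label algebra_simps)
qed

text \<open>The recursion tests a cell only against the highest label below it. In the induction
  step a first label \<open>l\<close> replaces \<open>b\<close>, and \<open>l\<close> being \<beta>
  or \<delta> is the negation of its being \<alpha> or \<gamma>; the condition on \<open>b\<close>
  thus turns into the pair condition for the first cell.\<close>

lemma mem_columns_iff:
  "c \<in> columns b s \<longleftrightarrow> length c = length s \<and>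
     (\<forall>i<length s. c ! i \<noteq> None \<longrightarrow> s ! i \<in> {Alpha, Gamma} \<and> b \<in> {Beta, Delta}) \<and>
     (\<forall>i i'. i < i' \<and> i' < length s \<and> c ! i \<in> {Some Alpha, Some Gamma} \<longrightarrow> c ! i' = None)"
proof (induction s arbitrary: b c)
  case Nil
  show ?case by auto
next
  case (Cons r s)
  show ?case
  proof (cases c)
    case Nil
    then show ?thesis by auto
  next
    case c: (Cons x c')
    \<comment> \<open>Pairs of positions are split according to whether the smaller one is the first
      position.\<close>
    have pairs: "(\<forall>i i'. i < i' \<and> i' < Suc m \<and> P i \<longrightarrow> R i') \<longleftrightarrow>
        (P 0 \<longrightarrow> (\<forall>i'<m. R (Suc i'))) \<and>
        (\<forall>i i'. i < i' \<and> i' < m \<and> P (Suc i) \<longrightarrow> R (Suc i'))" (is "?L = ?R")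
      for P R :: "nat \<Rightarrow> bool" and m
    proof
      assume ?L
      then show ?R by auto
    next
      assume R: ?R
      show ?L
      proof (intro allI impI)
        fix i i' assume *: "i < i' \<and> i' < Suc m \<and> P i"
        then obtain k where "i' = Suc k" by (cases i') auto
        with R * show "R i'" by (cases i) auto
      qed
    qed
    have mem: "x # c' \<in> columns b (r # s) \<longleftrightarrow> (case x of None \<Rightarrow> c' \<in> columns b s
        | Some l \<Rightarrow> r \<in> {Alpha, Gamma} \<and> b \<in> {Beta, Delta} \<and> c' \<in> columns l s)"
      by (auto split: option.split)
    have key: "(R \<and> B \<and> Z \<and> (\<forall>i<m. P i \<longrightarrow> S i \<and> \<not> L) \<and> W) \<longleftrightarrow>
        Z \<and> (R \<and> B) \<and> (\<forall>i<m. P i \<longrightarrow> S i \<and> B) \<and> (L \<longrightarrow> (\<forall>i<m. \<not> P i)) \<and> W"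
      for R B Z L W :: bool and P S and m :: nat
      by blast
    have compl: "l \<in> {Beta, Delta} \<longleftrightarrow> \<not> Some l \<in> {Some Alpha, Some Gamma}" for l
      by (cases l) auto
    show ?thesis
    proof (cases x)
      case None
      then show ?thesis
        unfolding c mem length_Cons All_less_Suc2 pairs nth_Cons_0 nth_Cons_Suc Cons.IH by simp
    next
      case (Some l)
      then show ?thesis
        unfolding c mem length_Cons All_less_Suc2 pairs nth_Cons_0 nth_Cons_Suc Cons.IH
        using key[of "r \<in> {Alpha, Gamma}" "b \<in> {Beta, Delta}" "length c' = length s" "length s"
          "\<lambda>i. c' ! i \<noteq> None" "\<lambda>i. s ! i \<in> {Alpha, Gamma}" "Some l \<in> {Some Alpha, Some Gamma}"]
        by (simp del: insert_iff add: compl[of l])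
    qed
  qed
qed

primrec last_label :: "label \<Rightarrow> label option list \<Rightarrow> label" where
  "last_label b [] = b"
| "last_label b (x # c) = last_label (case x of None \<Rightarrow> b | Some l \<Rightarrow> l) c"

lemma last_label_snoc:
  "last_label b (c @ [x]) = (case x of None \<Rightarrow> last_label b c | Some l \<Rightarrow> l)"
  by (induction c arbitrary: b) (auto split: option.split)

text \<open>When the recursion reaches cell \<open>i\<close>, its first argument is the highest
  label among \<open>b\<close> and the first \<open>i\<close> cells.\<close>

lemma column_weight_prod:
  "length c = length s \<Longrightarrow> column_weight b s c = (\<Prod>i<length c. case c ! i of
     None \<Rightarrow> gap (last_label b (take i c)) (s ! i) | Some l \<Rightarrow> var (Label l))"
proof (induction c arbitrary: b s)
  case (Cons x c)
  then obtain r s' where "s = r # s'" by (cases s) auto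
  with Cons show ?case
    by (simp add: prod.lessThan_Suc_shift del: prod.lessThan_Suc cong: option.case_cong
        split: option.split)
qed simp

text \<open>Links the maximum in \<open>below_label\<close> to the recursive
  \<open>last_label\<close>. \<open>C\<close> is a whole column with its diagonal label
  \<open>b\<close> at index 0, hence the \<open>tl\<close>; that label keeps the set
  nonempty.\<close>

lemma Max_last_label:
  assumes "C ! 0 = Some b" "i < length C"
  shows "the (C ! Max {k. k \<le> i \<and> C ! k \<noteq> None}) = last_label b (take i (tl C))"
  using assms(2)
proof (induction i)
  case 0
  have "{k. k \<le> 0 \<and> C ! k \<noteq> None} = {0}" using assms(1) by auto
  then have "Max {k. k \<le> 0 \<and> C ! k \<noteq> None} = 0" by (simp only: Max_singleton)
  then show ?case using assms(1) by (simp only: take_0 last_label.simps option.sel)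
next
  case (Suc i)
  have take: "take (Suc i) (tl C) = take i (tl C) @ [C ! Suc i]"
    using Suc.prems by (subst take_Suc_conv_app_nth) (auto simp: nth_tl)
  show ?case
  proof (cases "C ! Suc i")
    case None
    then have "k \<le> Suc i \<and> C ! k \<noteq> None \<longleftrightarrow> k \<le> i \<and> C ! k \<noteq> None" for k
      by (cases "k = Suc i") auto
    then show ?thesis
      using Suc by (simp only: take last_label_snoc None option.case Suc_lessD)
  next
    case (Some l)
    then have "Max {k. k \<le> Suc i \<and> C ! k \<noteq> None} = Suc i"
      by (intro Max_eqI) auto
    then show ?thesis by (simp only: take last_label_snoc Some option.case option.sel)
  qed
qed

section \<open>Row labels and cell weights of tableaux\<close>

text \<open>A form convenient for shifted cells: labels occur only inside the shape, so a labelled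
  cell always satisfies the index bounds.\<close>

lemma staircase_tableaux_iff:
  "T \<in> staircase_tableaux n \<longleftrightarrow> dom T \<subseteq> staircase_shape n \<and>
     (\<forall>i. 1 \<le> i \<and> i \<le> n \<longrightarrow> T (i, i) \<noteq> None) \<and>
     (\<forall>i i' j. i < i' \<and> T (i, j) \<in> {Some Alpha, Some Gamma} \<longrightarrow> T (i', j) = None) \<and>
     (\<forall>i j j'. j' < j \<and> T (i, j) \<in> {Some Beta, Some Delta} \<longrightarrow> T (i, j') = None)"
  (is "?L \<longleftrightarrow> ?R")
proof -
  have shape: "(i, j) \<in> staircase_shape n" if "dom T \<subseteq> staircase_shape n" "T (i, j) \<noteq> None" for i j
    using that(1) by (rule subsetD) (simp add: domIff that(2))
  have labelled: "T (i, j) \<noteq> None" if "T (i, j) \<in> {Some x, Some y}" for i j x y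
    using that by auto
  show ?thesis
  proof
    assume ?L
    then have dom: "dom T \<subseteq> staircase_shape n"
      and diag: "\<forall>i. 1 \<le> i \<and> i \<le> n \<longrightarrow> T (i, i) \<noteq> None"
      and above: "\<forall>(i, j)\<in>staircase_shape n. T (i, j) \<in> {Some Alpha, Some Gamma} \<longrightarrow>
        (\<forall>i'. i < i' \<and> i' \<le> n \<longrightarrow> T (i', j) = None)"
      and left: "\<forall>(i, j)\<in>staircase_shape n. T (i, j) \<in> {Some Beta, Some Delta} \<longrightarrow>
        (\<forall>j'. 1 \<le> j' \<and> j' < j \<longrightarrow> T (i, j') = None)"
      unfolding staircase_tableaux_def mem_Collect_eq by - (elim conjE, assumption)+
    have "T (i', j) = None" if "i < i'" "T (i, j) \<in> {Some Alpha, Some Gamma}" for i i' j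
    proof (rule ccontr)
      assume *: "T (i', j) \<noteq> None"
      have le: "i' \<le> n" using shape[OF dom *] by (simp add: staircase_shape_def)
      have "\<forall>i'. i < i' \<and> i' \<le> n \<longrightarrow> T (i', j) = None"
        using bspec[OF above shape[OF dom labelled[OF that(2)]], unfolded prod.case] that(2) by (rule mp)
      from this[THEN spec, THEN mp, OF conjI[OF that(1) le]] * show False by contradiction
    qed
    moreover have "T (i, j') = None" if "j' < j" "T (i, j) \<in> {Some Beta, Some Delta}" for i j j'
    proof (rule ccontr)
      assume *: "T (i, j') \<noteq> None"
      have le: "1 \<le> j'" using shape[OF dom *] by (simp add: staircase_shape_def)
      have "\<forall>j'. 1 \<le> j' \<and> j' < j \<longrightarrow> T (i, j') = None"
        using bspec[OF left shape[OF dom labelled[OF that(2)]], unfolded prod.case] that(2) by (rule mp)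
      from this[THEN spec, THEN mp, OF conjI[OF le that(1)]] * show False by contradiction
    qed
    ultimately show ?R
      using dom diag by metis
  next
    assume ?R
    then have dom: "dom T \<subseteq> staircase_shape n"
      and diag: "\<forall>i. 1 \<le> i \<and> i \<le> n \<longrightarrow> T (i, i) \<noteq> None"
      and above: "\<forall>i i' j. i < i' \<and> T (i, j) \<in> {Some Alpha, Some Gamma} \<longrightarrow> T (i', j) = None"
      and left: "\<forall>i j j'. j' < j \<and> T (i, j) \<in> {Some Beta, Some Delta} \<longrightarrow> T (i, j') = None"
      by - (elim conjE, assumption)+
    show ?L
      unfolding staircase_tableaux_def mem_Collect_eq
    proof (intro conjI ballI dom diag)
      fix e assume "e \<in> staircase_shape n"
      show "case e of (i, j) \<Rightarrow> T (i, j) \<in> {Some Alpha, Some Gamma} \<longrightarrow>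
          (\<forall>i'. i < i' \<and> i' \<le> n \<longrightarrow> T (i', j) = None)"
        by (cases e) (use above in \<open>simp only: prod.case, blast\<close>)
    next
      fix e assume "e \<in> staircase_shape n"
      show "case e of (i, j) \<Rightarrow> T (i, j) \<in> {Some Beta, Some Delta} \<longrightarrow>
          (\<forall>j'. 1 \<le> j' \<and> j' < j \<longrightarrow> T (i, j') = None)"
        by (cases e) (use left in \<open>simp only: prod.case, blast\<close>)
    qed
  qed
qed

lemma tableau_dom: "T \<in> staircase_tableaux n \<Longrightarrow> dom T \<subseteq> staircase_shape n"
  by (simp add: staircase_tableaux_iff)

lemma tableau_above:
  assumes "T \<in> staircase_tableaux n" "T (i, j) \<in> {Some Alpha, Some Gamma}" "i < i'"
  shows "T (i', j) = None"
proof -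
  have "\<forall>i i' j. i < i' \<and> T (i, j) \<in> {Some Alpha, Some Gamma} \<longrightarrow> T (i', j) = None"
    using assms(1) unfolding staircase_tableaux_iff by (elim conjE)
  from this[rule_format, OF conjI[OF assms(3,2)]] show ?thesis .
qed

lemma tableau_left:
  assumes "T \<in> staircase_tableaux n" "T (i, j) \<in> {Some Beta, Some Delta}" "j' < j"
  shows "T (i, j') = None"
proof -
  have "\<forall>i j j'. j' < j \<and> T (i, j) \<in> {Some Beta, Some Delta} \<longrightarrow> T (i, j') = None"
    using assms(1) unfolding staircase_tableaux_iff by (elim conjE)
  from this[rule_format, OF conjI[OF assms(3,2)]] show ?thesis .
qed

lemma tableau_diagonal:
  assumes "T \<in> staircase_tableaux n" "1 \<le> i" "i \<le> n"
  shows "T (i, i) \<noteq> None"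
proof -
  have "\<forall>i. 1 \<le> i \<and> i \<le> n \<longrightarrow> T (i, i) \<noteq> None"
    using assms(1) unfolding staircase_tableaux_iff by (elim conjE)
  from this[rule_format, OF conjI[OF assms(2,3)]] show ?thesis .
qed

text \<open>
  The virtual column 0 makes \<^const>\<open>right_label\<close> return the leftmost label of a row.
\<close>

definition row_labels :: "nat \<Rightarrow> filling \<Rightarrow> label list" where
  "row_labels n T = map (\<lambda>i. right_label T (Suc i, 0)) [0..<n]"

lemma length_row_labels [simp]: "length (row_labels n T) = n"
  by (simp add: row_labels_def)

text \<open>A \<beta> or \<delta> has only empty cells to its left and is therefore the leftmost
  label of its row.\<close>

lemma right_label_zero:
  assumes T: "T \<in> staircase_tableaux n" and i: "1 \<le> i" "i \<le> n"
  shows "right_label T (i, 0) \<in> {Alpha, Gamma} \<longleftrightarrow> (\<forall>j. T (i, j) \<notin> {Some Beta, Some Delta})"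
proof -
  define S where "S = {k. 0 < k \<and> k \<le> i \<and> T (i, k) \<noteq> None}"
  have S: "finite S" "S \<noteq> {}"
    using tableau_diagonal[OF T i] i by (auto simp: S_def)
  have "Min S \<in> S" using S by (rule Min_in)
  then obtain r where r: "T (i, Min S) = Some r" by (auto simp: S_def)
  then have label: "right_label T (i, 0) = r" by (simp add: right_label_def S_def)
  show ?thesis
  proof (cases "\<exists>j. T (i, j) \<in> {Some Beta, Some Delta}")
    case True
    then obtain j where j: "T (i, j) \<in> {Some Beta, Some Delta}" by blast
    then have "T (i, j) \<noteq> None" by auto
    then have "(i, j) \<in> staircase_shape n" by (intro subsetD[OF tableau_dom[OF T]]) (simp add: domIff)
    then have "j \<in> S" using j by (auto simp: S_def staircase_shape_def)
    then have "Min S \<le> j" using S by simp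
    moreover have "\<not> Min S < j"
    proof
      assume "Min S < j"
      then have "T (i, Min S) = None" by (rule tableau_left[OF T j])
      then show False using r by simp
    qed
    ultimately show ?thesis using j r label by auto
  next
    case False
    then show ?thesis using r label by (cases r) auto
  qed
qed

definition cell_weight :: "filling \<Rightarrow> cell \<Rightarrow> weight" where
  "cell_weight T e = (case T e of None \<Rightarrow> gap (below_label T e) (right_label T e)
     | Some l \<Rightarrow> var (Label l))"

text \<open>As a product over all cells of the shape, the weight can be split column by
  column.\<close>

lemma tableau_weight_prod:
  assumes "dom T \<subseteq> staircase_shape n"
  shows "tableau_weight n T = (\<Prod>e\<in>staircase_shape n. cell_weight T e)"
proof -
  let ?E = "staircase_shape n - dom T"
  have fin: "finite (staircase_shape n)" by (rule finite_staircase_shape)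
  have q: "q_cells n T = {e \<in> ?E. right_label T e = Delta \<or>
      right_label T e \<in> {Alpha, Gamma} \<and> below_label T e \<in> {Beta, Gamma}}"
    by (auto simp: q_cells_def)
  have "(\<Prod>e\<in>?E. cell_weight T e) = (\<Prod>e\<in>?E. if e \<in> q_cells n T then q else 1)"
    unfolding q by (rule prod.cong) (auto simp: cell_weight_def gap_def)
  also have "\<dots> = (\<Prod>e\<in>?E \<inter> q_cells n T. q)"
    using fin by (subst prod.inter_restrict) auto
  also have "\<dots> = q ^ card (q_cells n T)"
    by (auto simp: q intro!: arg_cong[of _ _ "\<lambda>A. q ^ card A"])
  finally have "(\<Prod>e\<in>?E. cell_weight T e) = q ^ card (q_cells n T)" .
  moreover have "(\<Prod>e\<in>dom T. cell_weight T e) = (\<Prod>e\<in>dom T. var (Label (the (T e))))"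
    by (rule prod.cong) (auto simp: cell_weight_def)
  ultimately show ?thesis
    using prod.subset_diff[OF assms fin, of "cell_weight T"]
    by (simp add: tableau_weight_def mult.commute)
qed

section \<open>Placing a column on the left of a tableau\<close>

text \<open>The new column becomes column 1 and its bottom cell forms a new row 1, so old cells move
  by one in both directions. Entry \<open>i\<close> of \<open>C\<close> stands in row
  \<open>i + 1\<close>; column 0 of \<open>T\<close> is forgotten.\<close>

fun extend :: "filling \<Rightarrow> label option list \<Rightarrow> filling" where
  "extend T C (Suc i, Suc 0) = (if i < length C then C ! i else None)"
| "extend T C (Suc i, Suc (Suc j)) = T (i, Suc j)"
| "extend T C (0, j) = None"
| "extend T C (i, 0) = None"

lemma extend_zero [simp]: "extend T C (i, 0) = None"
  by (cases i) auto

lemma tableau_outside: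
  "dom T \<subseteq> staircase_shape n \<Longrightarrow> \<not> (1 \<le> j \<and> j \<le> i \<and> i \<le> n) \<Longrightarrow> T (i, j) = None"
  by (auto simp: staircase_shape_def)

text \<open>The two search sets correspond under \<open>Suc\<close>. The case \<open>j = 0\<close>
  matters: seen from the new column, the nearest label to the right is the leftmost label of the old
  row.\<close>

lemma right_label_extend:
  assumes "T (i, i) \<noteq> None" "j < i"
  shows "right_label (extend T C) (Suc i, Suc j) = right_label T (i, j)"
proof -
  let ?S = "{k. j < k \<and> k \<le> i \<and> T (i, k) \<noteq> None}"
  have S: "finite ?S" "?S \<noteq> {}" using assms by auto
  have "k \<in> Suc ` ?S" if "Suc j < k" "k \<le> Suc i" "extend T C (Suc i, k) \<noteq> None" for k
    using that by (cases "(T, C, Suc i, k)" rule: extend.cases) auto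
  moreover have "extend T C (Suc i, Suc k) = T (i, k)" if "k \<in> ?S" for k
    using that by (cases k) auto
  ultimately have "{k. Suc j < k \<and> k \<le> Suc i \<and> extend T C (Suc i, k) \<noteq> None} = Suc ` ?S"
    by auto
  moreover have "Min (Suc ` ?S) = Suc (Min ?S)"
    using S by (intro mono_Min_commute[symmetric]) (auto simp: mono_def)
  \<comment> \<open>The minimum exceeds \<open>j\<close>, so it is a positive column, where
    \<open>extend\<close> copies \<open>T\<close>.\<close>
  moreover obtain k where "Min ?S = Suc k"
    using Min_in[OF S] by (cases "Min ?S") auto
  ultimately show ?thesis by (simp add: right_label_def)
qed

lemma right_label_extend_zero:
  assumes "i < length C"
  shows "right_label (extend T C) (Suc i, 0) = (case C ! i of
     None \<Rightarrow> right_label (extend T C) (Suc i, Suc 0) | Some l \<Rightarrow> l)"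
proof (cases "C ! i")
  case None
  then have "{k. 0 < k \<and> k \<le> Suc i \<and> extend T C (Suc i, k) \<noteq> None} =
      {k. Suc 0 < k \<and> k \<le> Suc i \<and> extend T C (Suc i, k) \<noteq> None}"
    by (auto intro!: Suc_lessI split: if_splits)
  then show ?thesis using None by (simp add: right_label_def)
next
  case (Some l)
  then have "Min {k. 0 < k \<and> k \<le> Suc i \<and> extend T C (Suc i, k) \<noteq> None} = Suc 0"
    using assms by (intro Min_eqI) auto
  then show ?thesis using Some assms by (simp add: right_label_def)
qed

lemma below_label_extend:
  assumes "T (Suc j, Suc j) \<noteq> None" "Suc j < i"
  shows "below_label (extend T C) (Suc i, Suc (Suc j)) = below_label T (i, Suc j)"
proof -
  let ?S = "{k. Suc j \<le> k \<and> k < i \<and> T (k, Suc j) \<noteq> None}"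
  have S: "finite ?S" "?S \<noteq> {}" using assms by auto
  have "k \<in> Suc ` ?S" if "Suc (Suc j) \<le> k" "k < Suc i" "extend T C (k, Suc (Suc j)) \<noteq> None" for k
    using that by (cases k) auto
  then have "{k. Suc (Suc j) \<le> k \<and> k < Suc i \<and> extend T C (k, Suc (Suc j)) \<noteq> None} = Suc ` ?S"
    by auto
  moreover have "Max (Suc ` ?S) = Suc (Max ?S)"
    using S by (intro mono_Max_commute[symmetric]) (auto simp: mono_def)
  ultimately show ?thesis by (simp add: below_label_def)
qed

text \<open>\<open>c\<close> begins above the diagonal cell, so its entry \<open>i\<close> stands in
  row \<open>i + 2\<close>.\<close>

lemma below_label_extend_first:
  assumes "i < length c"
  shows "below_label (extend T (Some l # c)) (Suc (Suc i), Suc 0) = last_label l (take i c)"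
proof -
  let ?C = "Some l # c"
  let ?S = "{k. k \<le> i \<and> ?C ! k \<noteq> None}"
  have S: "finite ?S" "?S \<noteq> {}" by (auto intro!: exI[of _ 0])
  have "k \<in> Suc ` ?S" if "Suc 0 \<le> k" "k < Suc (Suc i)" "extend T ?C (k, Suc 0) \<noteq> None" for k
    using that by (cases k) (auto split: if_splits)
  moreover have "extend T ?C (Suc k, Suc 0) \<noteq> None" if "k \<in> ?S" for k
    using that assms by auto
  ultimately have "{k. Suc 0 \<le> k \<and> k < Suc (Suc i) \<and> extend T ?C (k, Suc 0) \<noteq> None} = Suc ` ?S"
    by (auto simp del: extend.simps)
  moreover have "Max (Suc ` ?S) = Suc (Max ?S)"
    using S by (intro mono_Max_commute[symmetric]) (auto simp: mono_def)
  moreover have "Max ?S < length ?C"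
    using Max_in[OF S] assms by auto
  moreover have "the (?C ! Max ?S) = last_label l (take i (tl ?C))"
    using assms by (intro Max_last_label) auto
  ultimately show ?thesis by (simp add: below_label_def)
qed

lemma row_labels_extend:
  assumes T: "T \<in> staircase_tableaux n" and c: "length c = n"
  shows "row_labels (Suc n) (extend T (Some l # c)) = l # relabel (row_labels n T) c"
proof (rule nth_equalityI)
  fix i assume "i < length (row_labels (Suc n) (extend T (Some l # c)))"
  then have i: "i < Suc n" by simp
  show "row_labels (Suc n) (extend T (Some l # c)) ! i = (l # relabel (row_labels n T) c) ! i"
  proof (cases i)
    case 0
    then show ?thesis
      by (simp add: row_labels_def right_label_extend_zero del: upt_Suc)
  next
    case (Suc j)
    have "right_label (extend T (Some l # c)) (Suc (Suc j), Suc 0) = right_label T (Suc j, 0)"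
      using i Suc tableau_diagonal[OF T] by (intro right_label_extend) auto
    then show ?thesis
      using i Suc c
      by (simp add: row_labels_def relabel_def right_label_extend_zero del: upt_Suc
          split: option.split)
  qed
qed (use c in \<open>simp add: relabel_def\<close>)

lemma staircase_shape_Suc:
  "staircase_shape (Suc n) =
     map_prod Suc Suc ` staircase_shape n \<union> (\<lambda>i. (Suc i, Suc 0)) ` {..<Suc n}"
proof -
  have "(i, j) \<in> map_prod Suc Suc ` staircase_shape n \<union> (\<lambda>i. (Suc i, Suc 0)) ` {..<Suc n}"
    if "(i, j) \<in> staircase_shape (Suc n)" for i j
  proof (cases "j = Suc 0")
    case True
    then show ?thesis using that by (cases i) (auto simp: staircase_shape_def)
  next
    case False
    with that have ij: "1 < j" "j \<le> i" "i \<le> Suc n" by (auto simp: staircase_shape_def)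
    then have "(i, j) = map_prod Suc Suc (i - 1, j - 1)" "(i - 1, j - 1) \<in> staircase_shape n"
      by (auto simp: staircase_shape_def)
    then show ?thesis by blast
  qed
  then show ?thesis by (auto simp: staircase_shape_def)
qed

lemma dom_extend:
  assumes dom: "dom T \<subseteq> staircase_shape n" and C: "length C = Suc n"
  shows "dom (extend T C) \<subseteq> staircase_shape (Suc n)"
proof
  fix e assume "e \<in> dom (extend T C)"
  then obtain x where x: "extend T C e = Some x" by blast
  show "e \<in> staircase_shape (Suc n)"
  proof (cases "(T, C, e)" rule: extend.cases)
    case (1 T' C' i)
    then show ?thesis using x C by (simp add: staircase_shape_def split: if_splits)
  next
    case (2 T' C' i j)
    then have "T (i, Suc j) = Some x" using x by simp
    then have "(i, Suc j) \<in> staircase_shape n" using dom by blast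
    then show ?thesis using 2 by (simp add: staircase_shape_def)
  qed (use x in auto)
qed

text \<open>The product over the cells splits into old cells and new column. The nearest labels to
  the right of and below an old empty cell are old ones, so its weight survives the shift.\<close>

lemma tableau_weight_extend:
  assumes T: "T \<in> staircase_tableaux n" and c: "length c = n"
  shows "tableau_weight (Suc n) (extend T (Some l # c)) =
     tableau_weight n T * (var (Label l) * column_weight l (row_labels n T) c)"
proof -
  let ?E = "extend T (Some l # c)"
  have dom: "dom T \<subseteq> staircase_shape n" using T by (rule tableau_dom)
  have old: "cell_weight ?E (map_prod Suc Suc e) = cell_weight T e" if "e \<in> staircase_shape n" for e
  proof -
    obtain i j where e: "e = (i, Suc j)" "Suc j \<le> i" "i \<le> n"
      using \<open>e \<in> staircase_shape n\<close> by (cases e; cases "snd e") (auto simp: staircase_shape_def)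
    show ?thesis
    proof (cases "T e")
      case None
      \<comment> \<open>Diagonal cells are labelled, so an empty cell lies strictly above the
        diagonal, as the shift lemmas require.\<close>
      then have "Suc j < i" using e tableau_diagonal[OF T] by (cases "Suc j = i") auto
      then show ?thesis
        using e None tableau_diagonal[OF T]
        by (simp add: cell_weight_def right_label_extend below_label_extend)
    qed (use e in \<open>simp add: cell_weight_def\<close>)
  qed
  have new: "cell_weight ?E (Suc (Suc i), Suc 0) = (case c ! i of
     None \<Rightarrow> gap (last_label l (take i c)) (row_labels n T ! i) | Some l \<Rightarrow> var (Label l))"
    if "i < n" for i
    using that c tableau_diagonal[OF T, of "Suc i"]
    by (auto simp: cell_weight_def right_label_extend below_label_extend_first row_labels_def
        split: option.split)
  have "tableau_weight (Suc n) ?E = (\<Prod>e\<in>staircase_shape (Suc n). cell_weight ?E e)"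
    using dom c by (intro tableau_weight_prod dom_extend) auto
  also have "\<dots> = (\<Prod>e\<in>map_prod Suc Suc ` staircase_shape n. cell_weight ?E e) *
      (\<Prod>e\<in>(\<lambda>i. (Suc i, Suc 0)) ` {..<Suc n}. cell_weight ?E e)"
    unfolding staircase_shape_Suc
    by (rule prod.union_disjoint) (auto simp: finite_staircase_shape, auto simp: staircase_shape_def)
  also have "(\<Prod>e\<in>map_prod Suc Suc ` staircase_shape n. cell_weight ?E e) = tableau_weight n T"
    unfolding tableau_weight_prod[OF dom]
    by (subst prod.reindex) (auto simp: inj_on_def old)
  also have "(\<Prod>e\<in>(\<lambda>i. (Suc i, Suc 0)) ` {..<Suc n}. cell_weight ?E e) =
      var (Label l) * (\<Prod>i<n. cell_weight ?E (Suc (Suc i), Suc 0))"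
    by (subst prod.reindex)
      (auto simp: inj_on_def prod.lessThan_Suc_shift cell_weight_def simp del: prod.lessThan_Suc)
  also have "(\<Prod>i<n. cell_weight ?E (Suc (Suc i), Suc 0)) = column_weight l (row_labels n T) c"
    using c by (subst column_weight_prod) (auto simp: new)
  finally show ?thesis .
qed

lemma tableau_type_extend:
  "tableau_type (Suc n) (extend T (Some l # c)) = tableau_type n T @ [letter_of_label l]"
proof -
  have "rev [1..<Suc (Suc n)] = map Suc (rev [1..<Suc n]) @ [1]"
    by (metis One_nat_def map_Suc_upt rev.simps(2) rev_map upt_conv_Cons zero_less_Suc Suc_less_eq)
  moreover have "extend T (Some l # c) (Suc i, Suc i) = T (i, i)" if "1 \<le> i" for i
    using that by (cases i) auto
  ultimately show ?thesis
    unfolding tableau_type_def by (auto simp del: upt_Suc)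
qed

text \<open>The conditions among old cells are those of \<open>T\<close>, shifted. Within the new
  column they are the conditions of \<open>mem_columns_iff\<close>. Between the two, the cells left
  of a \<beta> or \<delta> of \<open>T\<close> must be empty, which by
  \<open>right_label_zero\<close> means that only open rows receive labels.\<close>

lemma extend_mem_iff:
  assumes dom: "dom T \<subseteq> staircase_shape n" and c: "length c = n"
  shows "extend T (Some l # c) \<in> staircase_tableaux (Suc n) \<longleftrightarrow>
     T \<in> staircase_tableaux n \<and> c \<in> columns l (row_labels n T)"
    (is "?E \<in> _ \<longleftrightarrow> _")
proof
  assume E: "?E \<in> staircase_tableaux (Suc n)"
  \<comment> \<open>A labelled cell of \<open>T\<close> lies in a positive column; at
    \<open>j = 0\<close> the left side would be a cell of the new column.\<close>
  have shift: "?E (Suc i, Suc j) = T (i, j)" if "T (i, j) \<noteq> None" for i j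
    using tableau_outside[OF dom, of j i] that by (cases j) auto
  have T: "T \<in> staircase_tableaux n"
    unfolding staircase_tableaux_iff
  proof (intro conjI allI impI dom)
    fix i assume "1 \<le> i \<and> i \<le> n"
    then show "T (i, i) \<noteq> None" using tableau_diagonal[OF E, of "Suc i"] by (cases i) auto
  next
    fix i i' j assume *: "i < i' \<and> T (i, j) \<in> {Some Alpha, Some Gamma}"
    then have "?E (Suc i, Suc j) \<in> {Some Alpha, Some Gamma}" by (subst shift) auto
    then have "?E (Suc i', Suc j) = None" by (rule tableau_above[OF E]) (use * in simp)
    then show "T (i', j) = None" using shift[of i' j] by force
  next
    fix i j j' assume *: "j' < j \<and> T (i, j) \<in> {Some Beta, Some Delta}"
    then have "?E (Suc i, Suc j) \<in> {Some Beta, Some Delta}" by (subst shift) auto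
    then have "?E (Suc i, Suc j') = None" by (rule tableau_left[OF E]) (use * in simp)
    then show "T (i, j') = None" using shift[of i j'] by force
  qed
  have col: "(Some l # c) ! i' = None"
    if "i < i'" "i' \<le> n" "(Some l # c) ! i \<in> {Some Alpha, Some Gamma}" for i i'
  proof -
    have "?E (Suc i, Suc 0) \<in> {Some Alpha, Some Gamma}" using that c by simp
    then have "?E (Suc i', Suc 0) = None" by (rule tableau_above[OF E]) (use that(1) in simp)
    then show ?thesis using that c by simp
  qed
  have "c \<in> columns l (row_labels n T)"
    unfolding mem_columns_iff length_row_labels
  proof (intro conjI allI impI c)
    fix i assume i: "i < n" "c ! i \<noteq> None"
    have "T (Suc i, j) \<notin> {Some Beta, Some Delta}" for j
    proof
      assume *: "T (Suc i, j) \<in> {Some Beta, Some Delta}"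
      then have label: "?E (Suc (Suc i), Suc j) \<in> {Some Beta, Some Delta}" by (subst shift) auto
      have "0 < j" using * tableau_outside[OF dom, of j "Suc i"] by (cases j) auto
      then have "?E (Suc (Suc i), Suc 0) = None" by (intro tableau_left[OF E label]) simp
      then show False using i c by simp
    qed
    then show "row_labels n T ! i \<in> {Alpha, Gamma}"
      using right_label_zero[OF T, of "Suc i"] i by (simp add: row_labels_def)
    show "l \<in> {Beta, Delta}"
      using col[of 0 "Suc i"] i by (cases l) auto
  next
    fix i i' assume "i < i' \<and> i' < n \<and> c ! i \<in> {Some Alpha, Some Gamma}"
    then show "c ! i' = None" using col[of "Suc i" "Suc i'"] by simp
  qed
  with T show "T \<in> staircase_tableaux n \<and> c \<in> columns l (row_labels n T)" ..
next
  assume "T \<in> staircase_tableaux n \<and> c \<in> columns l (row_labels n T)"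
  then have T: "T \<in> staircase_tableaux n" and "c \<in> columns l (row_labels n T)" by auto
  then have rows: "\<And>i. i < n \<Longrightarrow> c ! i \<noteq> None \<Longrightarrow> row_labels n T ! i \<in> {Alpha, Gamma}"
    and first: "\<And>i. i < n \<Longrightarrow> c ! i \<noteq> None \<Longrightarrow> l \<in> {Beta, Delta}"
    and later: "\<And>i i'. i < i' \<Longrightarrow> i' < n \<Longrightarrow> c ! i \<in> {Some Alpha, Some Gamma} \<Longrightarrow> c ! i' = None"
    unfolding mem_columns_iff length_row_labels by blast+
  show "?E \<in> staircase_tableaux (Suc n)"
    unfolding staircase_tableaux_iff
  proof (intro conjI allI impI dom_extend[OF dom])
    fix i assume "1 \<le> i \<and> i \<le> Suc n"
    then show "?E (i, i) \<noteq> None"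
      using tableau_diagonal[OF T, of "i - 1"] by (cases "(T, c, i, i)" rule: extend.cases) auto
  next
    fix i i' j assume *: "i < i' \<and> ?E (i, j) \<in> {Some Alpha, Some Gamma}"
    then obtain k k' where k: "i = Suc k" "i' = Suc k'" "k < k'" by (cases i; cases i') auto
    show "?E (i', j) = None"
    proof (cases "(T, c, i, j)" rule: extend.cases)
      case (1 _ _ _)
      \<comment> \<open>The label stands in the new column: \<open>k = 0\<close> is the diagonal
        cell, and otherwise its index in \<open>c\<close> is \<open>k - 1\<close>.\<close>
      show ?thesis
      proof (cases k)
        case 0
        then show ?thesis using * k 1 first[of "k' - 1"] c
          by (cases k'; cases "c ! (k' - 1)") auto
      next
        case (Suc m)
        then show ?thesis using * k 1 later[of m "k' - 1"] c
          by (cases k') (auto split: if_splits)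
      qed
    next
      case (2 _ _ _ m)
      then have "T (k, Suc m) \<in> {Some Alpha, Some Gamma}" using * k by simp
      then have "T (k', Suc m) = None" using k(3) by (rule tableau_above[OF T])
      then show ?thesis using 2 k by simp
    qed (use * in auto)
  next
    fix i j j' assume *: "j' < j \<and> ?E (i, j) \<in> {Some Beta, Some Delta}"
    show "?E (i, j') = None"
    proof (cases "(T, c, i, j)" rule: extend.cases)
      case (2 _ _ k m)
      then have T': "T (k, Suc m) \<in> {Some Beta, Some Delta}" using * by simp
      show ?thesis
      proof (cases "(T, c, i, j')" rule: extend.cases)
        case (1 _ _ _)
        have k: "1 \<le> k" "k \<le> n"
          using T' tableau_outside[OF dom, of "Suc m" k] by (cases k; auto)+
        then obtain p where p: "k = Suc p" "p < n" by (cases k) auto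
        \<comment> \<open>This row of \<open>T\<close> contains a \<beta> or \<delta>, so it is not
          open and the new column leaves it empty.\<close>
        have "right_label T (k, 0) \<notin> {Alpha, Gamma}"
          using right_label_zero[OF T k] T' by blast
        then have "c ! p = None"
          using rows[of p] p by (cases "c ! p") (auto simp: row_labels_def)
        then show ?thesis using 1 2 p c by simp
      next
        case (2 _ _ k' m')
        then have "k' = k" "Suc m' < Suc m" using * \<open>(T, c, i, j) = _\<close> by auto
        then have "T (k, Suc m') = None" by (intro tableau_left[OF T T'])
        then show ?thesis using 2 \<open>k' = k\<close> by simp
      qed auto
    qed (use * in auto)
  qed (use c in simp)
qed

section \<open>Decomposition and summation over all tableaux\<close>

lemma tableau_Suc_cases:
  assumes E: "E \<in> staircase_tableaux (Suc n)"
  obtains T l c where "dom T \<subseteq> staircase_shape n" "length c = n" "E = extend T (Some l # c)"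
proof -
  \<comment> \<open>Without the case \<open>j = 0\<close>, the first column of \<open>E\<close>
    would reappear in column 0, outside the shape.\<close>
  define T where "T = (\<lambda>(i, j). if j = 0 then None else E (Suc i, Suc j))"
  define C where "C = map (\<lambda>i. E (Suc i, Suc 0)) [0..<Suc n]"
  have dom: "dom E \<subseteq> staircase_shape (Suc n)" using E by (rule tableau_dom)
  have "dom T \<subseteq> staircase_shape n"
    using dom by (fastforce simp: T_def staircase_shape_def split: if_splits)
  moreover have "E = extend T C"
  proof
    fix e
    show "E e = extend T C e"
      using tableau_outside[OF dom, of "snd e" "fst e"]
      by (cases "(T, C, e)" rule: extend.cases) (auto simp: T_def C_def simp del: upt_Suc)
  qed
  moreover obtain l where "E (Suc 0, Suc 0) = Some l"
    using tableau_diagonal[OF E, of "Suc 0"] by auto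
  then have "C = Some l # tl C" "length (tl C) = n"
    by (auto simp: C_def upt_conv_Cons simp del: upt_Suc)
  ultimately show thesis using that by metis
qed

text \<open>\<open>extend\<close> forgets only column 0 of \<open>T\<close>, which is empty by the
  assumption on the domain.\<close>

lemma extend_inject:
  assumes "dom T \<subseteq> staircase_shape n" "dom T' \<subseteq> staircase_shape n"
    and "length C = Suc n" "length C' = Suc n" and eq: "extend T C = extend T' C'"
  shows "T = T' \<and> C = C'"
proof
  have "T (i, j) = T' (i, j)" for i j
    using fun_cong[OF eq, of "(Suc i, Suc j)"] tableau_outside[OF assms(1), of j i]
      tableau_outside[OF assms(2), of j i] by (cases j) auto
  then show "T = T'" by auto
  show "C = C'"
  proof (rule nth_equalityI)
    fix i assume "i < length C"
    then show "C ! i = C' ! i" using fun_cong[OF eq, of "(Suc i, Suc 0)"] assms(3,4) by simp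
  qed (use assms in simp)
qed

text \<open>The induction needs an arbitrary function \<open>f\<close> of the final state: deleting
  the leftmost column, which carries the last letter \<open>a\<close> of the type, replaces
  \<open>f\<close> by \<open>add_column a f\<close>.\<close>

lemma sum_tableaux:
  "(\<Sum>T | T \<in> staircase_tableaux (length m) \<and> tableau_type (length m) T = m.
      tableau_weight (length m) T *
      f (opens (row_labels (length m) T)) (deltas (row_labels (length m) T)))
   = add_columns m f 0 0"
proof (induction m arbitrary: f rule: rev_induct)
  case Nil
  have "staircase_shape 0 = {}" by (auto simp: staircase_shape_def)
  then have "staircase_tableaux 0 = {Map.empty}"
    unfolding staircase_tableaux_def by simp
  then have "{T. T \<in> staircase_tableaux 0 \<and> tableau_type 0 T = []} = {Map.empty}"
    by (auto simp: tableau_type_def)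
  then show ?case
    using \<open>staircase_shape 0 = {}\<close>
    by (simp add: tableau_weight_prod row_labels_def opens_def deltas_def)
next
  case (snoc a m)
  define n where "n = length m"
  define A where "A = {T. T \<in> staircase_tableaux n \<and> tableau_type n T = m}"
  \<comment> \<open>\<open>B\<close> records the tableau without its first column, the diagonal
    label of that column and the cells above it; \<open>g\<close> reassembles them
    bijectively.\<close>
  define B where "B = (SIGMA T:A. SIGMA l:{l. letter_of_label l = a}. columns l (row_labels n T))"
  define g where "g = (\<lambda>(T, l, c). extend T (Some l # c))"
  define h where "h E = tableau_weight (Suc n) E *
      f (opens (row_labels (Suc n) E)) (deltas (row_labels (Suc n) E))" for E
  have A: "T \<in> staircase_tableaux n" "dom T \<subseteq> staircase_shape n" if "T \<in> A" for T
    using that by (simp_all add: A_def, simp add: staircase_tableaux_iff)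
  have len: "length c = n" if "c \<in> columns l (row_labels n T)" for c l T
    using that by (simp add: mem_columns_iff)
  have fin: "finite A" "finite {l. letter_of_label l = a}"
    using finite_staircase_tableaux[of n]
    by (simp_all add: A_def) (cases a; simp add: labels_of_letter)
  have "inj_on g B"
  proof (rule inj_onI)
    fix x y assume *: "x \<in> B" "y \<in> B" "g x = g y"
    obtain T l c T' l' c' where xy: "x = (T, l, c)" "y = (T', l', c')"
      by (cases x; cases y)
    with * have "T \<in> A" "T' \<in> A" "length c = n" "length c' = n"
      by (auto simp: B_def len)
    then have "T = T' \<and> Some l # c = Some l' # c'"
      using * by (intro extend_inject[of _ n]) (simp_all add: A xy g_def)
    then show "x = y" by (simp add: xy)
  qed
  moreover have "g ` B = {E. E \<in> staircase_tableaux (Suc n) \<and> tableau_type (Suc n) E = m @ [a]}"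
  proof (intro equalityI subsetI)
    fix E assume "E \<in> g ` B"
    then obtain T l c where T: "T \<in> A" "letter_of_label l = a" "c \<in> columns l (row_labels n T)"
        "E = extend T (Some l # c)"
      by (auto simp: B_def g_def)
    then have "tableau_type n T = m" by (simp add: A_def)
    with T show "E \<in> {E. E \<in> staircase_tableaux (Suc n) \<and> tableau_type (Suc n) E = m @ [a]}"
      by (simp add: tableau_type_extend extend_mem_iff A len)
  next
    fix E assume E: "E \<in> {E. E \<in> staircase_tableaux (Suc n) \<and> tableau_type (Suc n) E = m @ [a]}"
    then obtain T l c where T: "dom T \<subseteq> staircase_shape n" "length c = n" "E = extend T (Some l # c)"
      using tableau_Suc_cases by blast
    with E have "(T, l, c) \<in> B"
      by (simp add: B_def A_def extend_mem_iff tableau_type_extend)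
    moreover have "g (T, l, c) = E" by (simp add: g_def T)
    ultimately show "E \<in> g ` B" by blast
  qed
  ultimately have "(\<Sum>E | E \<in> staircase_tableaux (Suc n) \<and> tableau_type (Suc n) E = m @ [a]. h E)
      = (\<Sum>x\<in>B. h (g x))"
    using sum.reindex[of g B h] by simp
  also have "\<dots> = (\<Sum>T\<in>A. \<Sum>l | letter_of_label l = a. \<Sum>c\<in>columns l (row_labels n T).
      h (extend T (Some l # c)))"
    unfolding B_def g_def using fin by (simp add: sum.Sigma case_prod_beta)
  also have "\<dots> = (\<Sum>T\<in>A. tableau_weight n T *
      add_column a f (opens (row_labels n T)) (deltas (row_labels n T)))"
  proof (rule sum.cong[OF refl])
    fix T assume T: "T \<in> A"
    let ?s = "row_labels n T"
    have "(\<Sum>c\<in>columns l ?s. h (extend T (Some l # c))) = tableau_weight n T * (q ^ deltas ?s *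
        (var (Label l) * column_sum l (opens ?s) (push l (\<lambda>i j. f i (j + deltas ?s)))))" for l
    proof -
      have "(\<Sum>c\<in>columns l ?s. h (extend T (Some l # c))) =
          (\<Sum>c\<in>columns l ?s. tableau_weight n T * var (Label l) * (column_weight l ?s c *
             push l f (opens (relabel ?s c)) (deltas (relabel ?s c))))"
        using A(1)[OF T] len
        by (intro sum.cong) (auto simp: h_def tableau_weight_extend row_labels_extend
            push_opens_deltas mult.assoc)
      also have "\<dots> = tableau_weight n T * var (Label l) * (q ^ deltas ?s *
          column_sum l (opens ?s) (\<lambda>k d. push l f k (d + deltas ?s)))"
        by (simp add: sum_distrib_left[symmetric] sum_columns)
      also have "(\<lambda>k d. push l f k (d + deltas ?s)) = push l (\<lambda>i j. f i (j + deltas ?s))"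
        by (auto simp: push_def fun_eq_iff)
      finally show ?thesis by (simp add: algebra_simps)
    qed
    then show "(\<Sum>l | letter_of_label l = a. \<Sum>c\<in>columns l ?s. h (extend T (Some l # c))) =
        tableau_weight n T * add_column a f (opens ?s) (deltas ?s)"
      by (simp add: add_column_def sum_distrib_left)
  qed
  also have "\<dots> = add_columns m (add_column a f) 0 0"
    unfolding A_def n_def by (rule snoc.IH)
  also have "\<dots> = add_columns (m @ [a]) f 0 0"
  proof -
    have "add_columns (X @ [a]) f = add_columns X (add_column a f)" for X
      by (induction X) auto
    then show ?thesis by simp
  qed
  finally show ?case by (simp add: h_def n_def)
qed

theorem theorem9:
  fixes n :: nat and m :: word
  assumes "n \<ge> 1" and "length m = n"
  shows "w m = (\<Sum>T\<in>{T \<in> staircase_tableaux n. tableau_type n T = m}. tableau_weight n T)"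
  \<comment> \<open>With \<open>f\<close> constantly 1 the sum is the total weight, and the right
    side is \<open>completions m 0 0\<close>.\<close>
  using sum_tableaux[of m "\<lambda>_ _. 1"] assms(2) by (simp add: w_eq_completions)

end
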